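(* Suppose that for any $x\in\mathbb{R}^n$ the function $t\mapsto\psi_p^t(x)$ is upper semicontinuous at $0^+$, and let $t_k\downarrow 0$. Then for any $x\in\mathbb{R}^n$, $\psi_p^{t_k}(x)\to\psi_p(x)$ as $k\to\infty$.
   Context: Setting. $F,f:\mathbb{R}^n\times\mathbb{R}^m\to\mathbb{R}$, $G:\mathbb{R}^n\to\mathbb{R}^p$, $g:\mathbb{R}^n\times\mathbb{R}^m\to\mathbb{R}^q$ are twice continuously differentiable. Let $X=\{x\in\mathbb{R}^n: G(x)\le 0\}$ and $S(x)=\arg\min_y\{f(x,y): g(x,y)\le 0\}$. Standing assumptions: $S(x)\neq\varnothing$ if $x\in X$ and $S(x)=\varnothing$ otherwise; $f$ and $g_1,\dots,g_q$ are convex in $y$; Slater condition: for every $x\in X$ there is $y(x)\in\mathbb{R}^m$ with $g_i(x,y(x))<0$ for all $i$. Let $\mathcal{L}(x,y,u)=\nabla_y f(x,y)+\sum_{i=1}^q u_i\nabla_y g_i(x,y)$ and $\mathcal{D}(x)=\{(y,u)\in\mathbb{R}^{m+q}: \mathcal{L}(x,y,u)=0,\ u\ge 0,\ g(x,y)\le 0,\ u^\top g(x,y)=0\}$; for $t>0$, $\mathcal{D}^t(x)=\{(y,u)\in\mathbb{R}^{m+q}: \mathcal{L}(x,y,u)=0,\ u\ge 0,\ g(x,y)\le 0,\ -u_ig_i(x,y)\le t,\ i=1,\dots,q\}$, assumed nonempty throughout. Put $\psi_p(x)=\max_{(y,u)\in\mathcal{D}(x)}F(x,y)$ and $\psi_p^t(x)=\max_{(y,u)\in\mathcal{D}^t(x)}F(x,y)$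 (optimal value functions; the value is understood as the supremum). By convention $\psi_p^0=\psi_p$, so upper semicontinuity of $t\mapsto\psi^t_p(x)$ at $0^+$ means $\limsup_{t\downarrow0}\psi_p^t(x)\le\psi_p(x)$. $t_k\downarrow 0$ means a sequence of positive numbers decreasing to $0$. *)

theory Defs
  imports "HOL-Analysis.Analysis"
begin

text \<open>Inequalities between vectors, such as \<open>G x \<le> 0\<close> or \<open>0 \<le> u\<close>, use the componentwise order
  on \<open>real ^ 'k\<close>.\<close>

text \<open>Twice continuous differentiability, as continuity of the second Frechet derivative.\<close>

definition twice_cont_diff :: "('a::real_normed_vector \<Rightarrow> 'b::real_normed_vector) \<Rightarrow> bool" where
  "twice_cont_diff h \<longleftrightarrow>
     (\<exists>(h' :: 'a \<Rightarrow> 'a \<Rightarrow>\<^sub>L 'b) (h'' :: 'a \<Rightarrow> 'a \<Rightarrow>\<^sub>L ('a \<Rightarrow>\<^sub>L 'b)).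
        (\<forall>z. (h has_derivative blinfun_apply (h' z)) (at z)) \<and>
        (\<forall>z. (h' has_derivative blinfun_apply (h'' z)) (at z)) \<and>
        continuous_on UNIV h'')"

text \<open>Only meaningful where \<open>h\<close> is differentiable; the vector is then unique.\<close>

definition gradient :: "('a::real_inner \<Rightarrow> real) \<Rightarrow> 'a \<Rightarrow> 'a" where
  "gradient h y = (THE d. GDERIV h y :> d)"

definition upper_feasible :: "(real ^ 'n \<Rightarrow> real ^ 'p) \<Rightarrow> (real ^ 'n) set" where
  "upper_feasible G = {x. G x \<le> 0}"

definition lower_solutions ::
    "((real ^ 'n) \<times> (real ^ 'm) \<Rightarrow> real) \<Rightarrow> ((real ^ 'n) \<times> (real ^ 'm) \<Rightarrow> real ^ 'q)
      \<Rightarrow> real ^ 'n \<Rightarrow> (real ^ 'm) set" where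
  "lower_solutions f g x = {y. is_arg_min (\<lambda>y. f (x, y)) (\<lambda>y. g (x, y) \<le> 0) y}"

text \<open>The \<open>y\<close>-gradient of the lower-level Lagrangian function.\<close>

definition lagr ::
    "((real ^ 'n) \<times> (real ^ 'm) \<Rightarrow> real) \<Rightarrow> ((real ^ 'n) \<times> (real ^ 'm) \<Rightarrow> real ^ 'q)
      \<Rightarrow> real ^ 'n \<Rightarrow> real ^ 'm \<Rightarrow> real ^ 'q \<Rightarrow> real ^ 'm" where
  "lagr f g x y u =
     gradient (\<lambda>y. f (x, y)) y + (\<Sum>i\<in>UNIV. (u $ i) *\<^sub>R gradient (\<lambda>y. g (x, y) $ i) y)"

definition kkt_set ::
    "((real ^ 'n) \<times> (real ^ 'm) \<Rightarrow> real) \<Rightarrow> ((real ^ 'n) \<times> (real ^ 'm) \<Rightarrow> real ^ 'q)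
      \<Rightarrow> real ^ 'n \<Rightarrow> ((real ^ 'm) \<times> (real ^ 'q)) set" where
  "kkt_set f g x =
     {(y, u). lagr f g x y u = 0 \<and> 0 \<le> u \<and> g (x, y) \<le> 0 \<and> u \<bullet> g (x, y) = 0}"

definition relaxed_kkt_set ::
    "((real ^ 'n) \<times> (real ^ 'm) \<Rightarrow> real) \<Rightarrow> ((real ^ 'n) \<times> (real ^ 'm) \<Rightarrow> real ^ 'q)
      \<Rightarrow> real \<Rightarrow> real ^ 'n \<Rightarrow> ((real ^ 'm) \<times> (real ^ 'q)) set" where
  "relaxed_kkt_set f g t x =
     {(y, u). lagr f g x y u = 0 \<and> 0 \<le> u \<and> g (x, y) \<le> 0 \<and>
              (\<forall>i. - (u $ i) * g (x, y) $ i \<le> t)}"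

text \<open>Optimal values are suprema in the extended reals: \<open>\<infinity>\<close> if \<open>F (x, _)\<close> is unbounded
  above, \<open>-\<infinity>\<close> if the set is empty, which happens for \<open>kkt_set f g x\<close> whenever the
  convex lower-level problem has no solution at \<open>x\<close>.\<close>

definition psi_p ::
    "((real ^ 'n) \<times> (real ^ 'm) \<Rightarrow> real) \<Rightarrow> ((real ^ 'n) \<times> (real ^ 'm) \<Rightarrow> real)
      \<Rightarrow> ((real ^ 'n) \<times> (real ^ 'm) \<Rightarrow> real ^ 'q) \<Rightarrow> real ^ 'n \<Rightarrow> ereal" where
  "psi_p F f g x = (SUP (y, u) \<in> kkt_set f g x. ereal (F (x, y)))"

definition psi_p_relaxed ::
    "((real ^ 'n) \<times> (real ^ 'm) \<Rightarrow> real) \<Rightarrow> ((real ^ 'n) \<times> (real ^ 'm) \<Rightarrow> real)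
      \<Rightarrow> ((real ^ 'n) \<times> (real ^ 'm) \<Rightarrow> real ^ 'q) \<Rightarrow> real \<Rightarrow> real ^ 'n \<Rightarrow> ereal" where
  "psi_p_relaxed F f g t x = (SUP (y, u) \<in> relaxed_kkt_set f g t x. ereal (F (x, y)))"

end

theory Submission
  imports Defs
begin

text \<open>The limit is a squeeze. Exact complementarity implies its relaxation, so the relaxed
  feasible set contains the exact one and \<open>psi_p_relaxed\<close> dominates
  \<open>psi_p\<close> for every parameter \<open>s \<ge> 0\<close>
  (\<open>kkt_set_subset_relaxed\<close>, \<open>psi_p_le_relaxed\<close>). In the other direction,
  upper semicontinuity at \<open>0\<close> from the right keeps the relaxed values from staying
  above \<open>psi_p\<close> as the parameter shrinks.\<close>

lemma kkt_set_subset_relaxed: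
  assumes "0 \<le> s"
  shows "kkt_set f g x \<subseteq> relaxed_kkt_set f g s x"
proof -
  have "- (u $ i) * g (x, y) $ i \<le> s"
    if u: "0 \<le> u" and g: "g (x, y) \<le> 0" and compl: "u \<bullet> g (x, y) = 0" for y u i
  proof -
    \<comment> \<open>Complementarity is given only for the inner product; since all terms have the
      same sign, a zero sum forces each of them to vanish.\<close>
    have "(\<Sum>j\<in>UNIV. - (u $ j * g (x, y) $ j)) = 0"
      using compl by (simp add: inner_vec_def sum_negf)
    moreover have "0 \<le> - (u $ j * g (x, y) $ j)" for j
      using u g by (simp add: less_eq_vec_def mult_nonneg_nonpos)
    ultimately have "- (u $ i * g (x, y) $ i) = 0"
      by (simp only: sum_nonneg_eq_0_iff finite_class.finite_UNIV) simp
    then show ?thesis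
      using assms by auto
  qed
  then show ?thesis
    by (auto simp: kkt_set_def relaxed_kkt_set_def)
qed

lemma psi_p_le_relaxed:
  "0 \<le> s \<Longrightarrow> psi_p F f g x \<le> psi_p_relaxed F f g s x"
  unfolding psi_p_def psi_p_relaxed_def by (intro SUP_subset_mono kkt_set_subset_relaxed order_refl)

theorem proposition2p2:
  fixes F f :: "(real ^ 'n) \<times> (real ^ 'm) \<Rightarrow> real"
    and G :: "real ^ 'n \<Rightarrow> real ^ 'p"
    and g :: "(real ^ 'n) \<times> (real ^ 'm) \<Rightarrow> real ^ 'q"
    and t :: "nat \<Rightarrow> real"
  assumes smooth: "twice_cont_diff F" "twice_cont_diff f" "twice_cont_diff G" "twice_cont_diff g"
    and solvable: "\<forall>x. lower_solutions f g x \<noteq> {} \<longleftrightarrow> x \<in> upper_feasible G"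
    and convex_f: "\<forall>x. convex_on UNIV (\<lambda>y. f (x, y))"
    and convex_g: "\<forall>x i. convex_on UNIV (\<lambda>y. g (x, y) $ i)"
    and slater: "\<forall>x \<in> upper_feasible G. \<exists>y. \<forall>i. g (x, y) $ i < 0"
    and relaxed_nonempty: "\<forall>x. \<forall>s>0. relaxed_kkt_set f g s x \<noteq> {}"
    and usc: "\<forall>x. Limsup (at_right 0) (\<lambda>s. psi_p_relaxed F f g s x) \<le> psi_p F f g x"
    and t_decreasing: "\<forall>k. 0 < t k" "decseq t" "t \<longlonglongrightarrow> 0"
  shows "\<forall>x. (\<lambda>k. psi_p_relaxed F f g (t k) x) \<longlonglongrightarrow> psi_p F f g x"
proof
  fix x
  show "(\<lambda>k. psi_p_relaxed F f g (t k) x) \<longlonglongrightarrow> psi_p F f g x"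
  \<comment> \<open>Testing against strict bounds \<open>a\<close> in the order topology of
    \<open>ereal\<close> treats infinite values uniformly: one of the two cases is then
    vacuous.\<close>
  proof (rule order_tendstoI)
    fix a assume "a < psi_p F f g x"
    then show "\<forall>\<^sub>F k in sequentially. a < psi_p_relaxed F f g (t k) x"
      using t_decreasing(1) by (intro always_eventually allI)
        (meson less_imp_le order_less_le_trans psi_p_le_relaxed)
  next
    fix a assume "psi_p F f g x < a"
    with usc have "Limsup (at_right 0) (\<lambda>s. psi_p_relaxed F f g s x) < a"
      by (meson order_le_less_trans)
    then have "\<forall>\<^sub>F s in at_right 0. psi_p_relaxed F f g s x < a"
      by (rule Limsup_lessD)
    \<comment> \<open>Strict positivity of \<open>t k\<close> matters here, because
      \<open>at_right 0\<close> excludes the point \<open>0\<close> itself.\<close>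
    moreover have "filterlim t (at_right 0) sequentially"
      using t_decreasing by (simp add: filterlim_at less_imp_neq[symmetric])
    ultimately show "\<forall>\<^sub>F k in sequentially. psi_p_relaxed F f g (t k) x < a"
      by (rule eventually_compose_filterlim)
  qed
qed

end
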